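(* Let $(M,\lambda_i(x,y),F(x,y))$ be an FP-space. The torsion and curvature tensors of the Berwald connection $B\Gamma=(G^\alpha_{\mu\nu},N^\alpha_\mu,0)$ can be expressed as follows. (a) The $(h)h$-, $(h)hv$-, $(v)hv$- and $(v)v$-torsion tensors of $B\Gamma$ vanish. (b) The $h$-, $v$- and $hv$-curvature tensors of $B\Gamma$ are given by: (1) $\bar R^\alpha_{\mu\nu\sigma}=\mathfrak U_{(\nu,\sigma)}\{P^\alpha_{\mu\nu|\sigma}+P^\eta_{\mu\nu}P^\alpha_{\eta\sigma}\}+P^\alpha_{\mu\eta}T^\eta_{\nu\sigma}-C^\alpha_{\mu\eta}R^\eta_{\nu\sigma}$; (2) $\bar S^\alpha_{\mu\sigma\nu}=0$; (3) $\bar P^\alpha_{\nu\mu\sigma}=\dot\partial_\sigma P^\alpha_{\nu\mu}+\dot\partial_\sigma\Gamma^\alpha_{\nu\mu}$. Here $\Gamma,C,T,P,R$ and the $h$-covariant derivative $|$ refer to the canonical connection.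
   Context: $M$ is a smooth $n$-dimensional manifold, $\pi:TM\to M$, $\tau M:=TM\setminus\{0\}$, $(x^\mu,y^\mu)$ the induced coordinates on $TM$, $\partial_\mu:=\partial/\partial x^\mu$, $\dot\partial_\mu:=\partial/\partial y^\mu$. Repeated indices (Greek, and the Latin index $i=1,\dots,n$) are summed. All objects live on $\tau M$. The pullback bundle $\pi^{-1}(TM)$ has fibre $T_xM$ over $(x,y)$; its sections have components $X^\alpha(x,y)$ transforming like vectors on $M$. $\mathfrak U_{(\nu,\sigma)}\{A_{\nu\sigma}\}:=A_{\nu\sigma}-A_{\sigma\nu}$. FP-space $(M,\lambda_i,F)$: $M$ together with $n$ global sections $\lambda_i$ of $\pi^{-1}(TM)$, smooth over $\tau M$ and linearly independent at each point, with components $\lambda_i^\alpha$ and inverse matrix $(\lambda_{i\alpha})$, such that, with $g_{\mu\nu}:=\lambda_{i\mu}\lambda_{i\nu}$: (1) $\dot\partial_\alpha g_{\mu\nu}$ is totally symmetric; (2) each $\lambda_i$ is positively homogeneous of degree zero in $y$; and $F:=\sqrt{g_{\mu\nu}y^\mu y^\nu}$. $g^{\mu\nu}$ is the inverse of $g_{\mu\nu}$. $\gamma^\alpha_{\mu\nu}:=\frac12g^{\alpha\eta}(\partial_\mu g_{\nu\eta}+\partial_\nu g_{\mu\eta}-\partial_\eta g_{\mu\nu})$; $G^\alpha:=\frac12\gamma^\alpha_{\mu\nu}y^\mu y^\nu$; $N^\alpha_\beta:=\dot\partial_\beta G^\alpha$ (Barthel connection); $G^\alpha_{\mu\nu}:=\dot\partial_\nu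 N^\alpha_\mu$; $\delta_\mu:=\partial_\mu-N^\alpha_\mu\dot\partial_\alpha$. Canonical connection $D=(\Gamma,N,C)$: $\Gamma^\alpha_{\mu\nu}=\lambda_i^\alpha\,\delta_\nu\lambda_{i\mu}$, $C^\alpha_{\mu\nu}=\lambda_i^\alpha\,\dot\partial_\nu\lambda_{i\mu}$. Its torsions used here: $T^\alpha_{\mu\nu}=\Gamma^\alpha_{\mu\nu}-\Gamma^\alpha_{\nu\mu}$, $R^\alpha_{\mu\nu}=\delta_\nu N^\alpha_\mu-\delta_\mu N^\alpha_\nu$, $P^\alpha_{\mu\nu}=\dot\partial_\nu N^\alpha_\mu-\Gamma^\alpha_{\mu\nu}$. Its $h$-covariant derivative: $X^\alpha_{\mu\nu|\beta}=\delta_\beta X^\alpha_{\mu\nu}+X^\eta_{\mu\nu}\Gamma^\alpha_{\eta\beta}-X^\alpha_{\eta\nu}\Gamma^\eta_{\mu\beta}-X^\alpha_{\mu\eta}\Gamma^\eta_{\nu\beta}$. For a Finsler connection $(\mathbf F,\mathbf N,\mathbf C)$: torsions: $(h)h$: $\mathbf T^\alpha_{\mu\nu}=\mathbf F^\alpha_{\mu\nu}-\mathbf F^\alpha_{\nu\mu}$; $(h)hv$: $\mathbf C^\alpha_{\mu\nu}$; $(v)h$: $\mathbf R^\alpha_{\mu\nu}=\delta_\nu\mathbf N^\alpha_\mu-\delta_\mu\mathbf N^\alpha_\nu$; $(v)hv$: $\mathbf P^\alpha_{\mu\nu}=\dot\partial_\nu\mathbf N^\alpha_\mu-\mathbf F^\alpha_{\mu\nu}$;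 $(v)v$: $\mathbf S^\alpha_{\mu\nu}=\mathbf C^\alpha_{\mu\nu}-\mathbf C^\alpha_{\nu\mu}$. Curvatures: $h$: $\mathbf R^\alpha_{\mu\nu\sigma}=\mathfrak U_{(\nu,\sigma)}\{\delta_\sigma\mathbf F^\alpha_{\mu\nu}+\mathbf F^\eta_{\mu\nu}\mathbf F^\alpha_{\eta\sigma}\}+\mathbf C^\alpha_{\mu\eta}\mathbf R^\eta_{\nu\sigma}$; $hv$: $\mathbf P^\alpha_{\mu\nu\sigma}=\dot\partial_\sigma\mathbf F^\alpha_{\mu\nu}-\mathbf C^\alpha_{\mu\sigma|\nu}+\mathbf C^\alpha_{\mu\eta}\mathbf P^\eta_{\nu\sigma}$ (with $|$ the $h$-covariant derivative of that connection); $v$: $\mathbf S^\alpha_{\mu\nu\sigma}=\mathfrak U_{(\nu,\sigma)}\{\dot\partial_\sigma\mathbf C^\alpha_{\mu\nu}+\mathbf C^\eta_{\mu\sigma}\mathbf C^\alpha_{\eta\nu}\}$. Those of the Berwald connection are denoted with a bar. *)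

theory Defs
  imports "HOL-Analysis.Analysis"
begin

section \<open>Smooth maps\<close>

primrec k_times_differentiable_on ::
  "nat \<Rightarrow> 'a::real_normed_vector set \<Rightarrow> ('a \<Rightarrow> 'b::real_normed_vector) \<Rightarrow> bool" where
  "k_times_differentiable_on 0 S f \<longleftrightarrow> continuous_on S f"
| "k_times_differentiable_on (Suc k) S f \<longleftrightarrow>
     (\<forall>x\<in>S. f differentiable (at x)) \<and>
     (\<forall>v. k_times_differentiable_on k S (\<lambda>x. frechet_derivative f (at x) v))"

text \<open>Only used for open sets of Euclidean spaces, where this is the usual notion of
  \<open>C\<^sup>\<infinity>\<close>: all iterated directional derivatives exist and are continuous.\<close>

definition smooth_on :: "'a::real_normed_vector set \<Rightarrow> ('a \<Rightarrow> 'b::real_normed_vector) \<Rightarrow> bool" where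
  "smooth_on S f \<longleftrightarrow> (\<forall>k. k_times_differentiable_on k S f)"


section \<open>Smooth manifolds and tangent vectors\<close>

type_synonym ('a, 'n) chart = "'a set \<times> ('a \<Rightarrow> real^'n)"

abbreviation cdom :: "('a, 'n) chart \<Rightarrow> 'a set" where "cdom \<equiv> fst"
abbreviation cmap :: "('a, 'n) chart \<Rightarrow> 'a \<Rightarrow> real^'n" where "cmap \<equiv> snd"
abbreviation cimage :: "('a, 'n) chart \<Rightarrow> (real^'n) set" where "cimage c \<equiv> cmap c ` cdom c"

definition cpoint :: "('a, 'n) chart \<Rightarrow> real^'n \<Rightarrow> 'a" where
  "cpoint c = inv_into (cdom c) (cmap c)"

definition transition :: "('a, 'n) chart \<Rightarrow> ('a, 'n) chart \<Rightarrow> real^'n \<Rightarrow> real^'n" where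
  "transition c c' = cmap c' \<circ> cpoint c"

text \<open>The atlas need not be maximal; the dimension is \<open>CARD('n)\<close>.\<close>

locale smooth_manifold =
  fixes M :: "'a topology" and A :: "('a, 'n::finite) chart set"
  assumes Hausdorff: "Hausdorff_space M"
    and countable_base: "second_countable M"
    and covering: "(\<Union>c\<in>A. cdom c) = topspace M"
    and chart_open: "c \<in> A \<Longrightarrow> openin M (cdom c) \<and> open (cimage c)"
    and chart_homeo: "c \<in> A \<Longrightarrow>
      homeomorphic_map (subtopology M (cdom c)) (top_of_set (cimage c)) (cmap c)"
    and compatible: "c \<in> A \<Longrightarrow> c' \<in> A \<Longrightarrow>
      smooth_on (cmap c ` (cdom c \<inter> cdom c')) (transition c c')"

text \<open>A tangent vector at \<open>p\<close> is the family of its components in the charts around \<open>p\<close>, related by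
  the contravariant transformation law; the family is \<open>0\<close> at all other arguments, so that
  equality of functions is equality of tangent vectors.\<close>

type_synonym ('a, 'n) tvec = "('a, 'n) chart \<Rightarrow> real^'n"

definition tangent_space :: "('a, 'n::finite) chart set \<Rightarrow> 'a \<Rightarrow> ('a, 'n) tvec set" where
  "tangent_space A p = {v.
     (\<forall>c. c \<notin> A \<or> p \<notin> cdom c \<longrightarrow> v c = 0) \<and>
     (\<forall>c\<in>A. \<forall>c'\<in>A. p \<in> cdom c \<longrightarrow> p \<in> cdom c' \<longrightarrow>
        v c' = frechet_derivative (transition c c') (at (cmap c p)) (v c))}"

definition slit_tangent_space :: "('a, 'n::finite) chart set \<Rightarrow> 'a \<Rightarrow> ('a, 'n) tvec set" where
  "slit_tangent_space A p = tangent_space A p - {\<lambda>_. 0}"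

text \<open>The tangent vector at \<open>p\<close> with components \<open>y\<close> in the chart \<open>c\<close>.\<close>

definition tvec_of ::
  "('a, 'n::finite) chart set \<Rightarrow> ('a, 'n) chart \<Rightarrow> 'a \<Rightarrow> real^'n \<Rightarrow> ('a, 'n) tvec" where
  "tvec_of A c p y = (\<lambda>c'. if c' \<in> A \<and> p \<in> cdom c'
     then frechet_derivative (transition c c') (at (cmap c p)) y else 0)"


section \<open>Calculus in the induced coordinates \<open>(x, y)\<close> of the tangent bundle\<close>

type_synonym 'n cfun = "(real^'n) \<times> (real^'n) \<Rightarrow> real"

definition pdx :: "'n::finite \<Rightarrow> 'n cfun \<Rightarrow> 'n cfun" where
  "pdx \<mu> f = (\<lambda>(x, y). deriv (\<lambda>t. f (x + t *\<^sub>R axis \<mu> 1, y)) 0)"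

definition pdy :: "'n::finite \<Rightarrow> 'n cfun \<Rightarrow> 'n cfun" where
  "pdy \<mu> f = (\<lambda>(x, y). deriv (\<lambda>t. f (x, y + t *\<^sub>R axis \<mu> 1)) 0)"

definition antisym_diff :: "('n \<Rightarrow> 'n \<Rightarrow> real) \<Rightarrow> 'n \<Rightarrow> 'n \<Rightarrow> real" where
  "antisym_diff X \<nu> \<sigma> = X \<nu> \<sigma> - X \<sigma> \<nu>"


section \<open>Finsler connections, their torsions and curvatures\<close>

text \<open>Local coefficients. In every indexed family the upper index comes first, followed by the lower
  indices in their written order: \<open>hcoef D \<alpha> \<mu> \<nu>\<close> is \<open>F\<^sup>\<alpha>\<^sub>\<mu>\<^sub>\<nu>\<close>, and \<open>nonlin D \<alpha> \<mu>\<close> is \<open>N\<^sup>\<alpha>\<^sub>\<mu>\<close>.\<close>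

record 'n finsler_connection =
  hcoef :: "'n \<Rightarrow> 'n \<Rightarrow> 'n \<Rightarrow> 'n cfun"
  nonlin :: "'n \<Rightarrow> 'n \<Rightarrow> 'n cfun"
  vcoef :: "'n \<Rightarrow> 'n \<Rightarrow> 'n \<Rightarrow> 'n cfun"

definition delta :: "('n::finite \<Rightarrow> 'n \<Rightarrow> 'n cfun) \<Rightarrow> 'n \<Rightarrow> 'n cfun \<Rightarrow> 'n cfun" where
  "delta N \<mu> f z = pdx \<mu> f z - (\<Sum>\<alpha>\<in>UNIV. N \<alpha> \<mu> z * pdy \<alpha> f z)"

definition hcov :: "'n::finite finsler_connection \<Rightarrow> ('n \<Rightarrow> 'n \<Rightarrow> 'n \<Rightarrow> 'n cfun) \<Rightarrow>
    'n \<Rightarrow> 'n \<Rightarrow> 'n \<Rightarrow> 'n \<Rightarrow> 'n cfun" where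
  "hcov D X \<alpha> \<mu> \<nu> \<beta> z = delta (nonlin D) \<beta> (X \<alpha> \<mu> \<nu>) z
     + (\<Sum>\<eta>\<in>UNIV. X \<eta> \<mu> \<nu> z * hcoef D \<alpha> \<eta> \<beta> z)
     - (\<Sum>\<eta>\<in>UNIV. X \<alpha> \<eta> \<nu> z * hcoef D \<eta> \<mu> \<beta> z)
     - (\<Sum>\<eta>\<in>UNIV. X \<alpha> \<mu> \<eta> z * hcoef D \<eta> \<nu> \<beta> z)"

definition h_h_torsion :: "'n::finite finsler_connection \<Rightarrow> 'n \<Rightarrow> 'n \<Rightarrow> 'n \<Rightarrow> 'n cfun" where
  "h_h_torsion D \<alpha> \<mu> \<nu> z = hcoef D \<alpha> \<mu> \<nu> z - hcoef D \<alpha> \<nu> \<mu> z"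

definition h_hv_torsion :: "'n::finite finsler_connection \<Rightarrow> 'n \<Rightarrow> 'n \<Rightarrow> 'n \<Rightarrow> 'n cfun" where
  "h_hv_torsion D \<alpha> \<mu> \<nu> z = vcoef D \<alpha> \<mu> \<nu> z"

definition v_h_torsion :: "'n::finite finsler_connection \<Rightarrow> 'n \<Rightarrow> 'n \<Rightarrow> 'n \<Rightarrow> 'n cfun" where
  "v_h_torsion D \<alpha> \<mu> \<nu> z =
     delta (nonlin D) \<nu> (nonlin D \<alpha> \<mu>) z - delta (nonlin D) \<mu> (nonlin D \<alpha> \<nu>) z"

definition v_hv_torsion :: "'n::finite finsler_connection \<Rightarrow> 'n \<Rightarrow> 'n \<Rightarrow> 'n \<Rightarrow> 'n cfun" where
  "v_hv_torsion D \<alpha> \<mu> \<nu> z = pdy \<nu> (nonlin D \<alpha> \<mu>) z - hcoef D \<alpha> \<mu> \<nu> z"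

definition v_v_torsion :: "'n::finite finsler_connection \<Rightarrow> 'n \<Rightarrow> 'n \<Rightarrow> 'n \<Rightarrow> 'n cfun" where
  "v_v_torsion D \<alpha> \<mu> \<nu> z = vcoef D \<alpha> \<mu> \<nu> z - vcoef D \<alpha> \<nu> \<mu> z"

definition h_curvature :: "'n::finite finsler_connection \<Rightarrow> 'n \<Rightarrow> 'n \<Rightarrow> 'n \<Rightarrow> 'n \<Rightarrow> 'n cfun" where
  "h_curvature D \<alpha> \<mu> \<nu> \<sigma> z =
     antisym_diff (\<lambda>\<nu> \<sigma>. delta (nonlin D) \<sigma> (hcoef D \<alpha> \<mu> \<nu>) z
        + (\<Sum>\<eta>\<in>UNIV. hcoef D \<eta> \<mu> \<nu> z * hcoef D \<alpha> \<eta> \<sigma> z)) \<nu> \<sigma>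
     + (\<Sum>\<eta>\<in>UNIV. vcoef D \<alpha> \<mu> \<eta> z * v_h_torsion D \<eta> \<nu> \<sigma> z)"

definition hv_curvature :: "'n::finite finsler_connection \<Rightarrow> 'n \<Rightarrow> 'n \<Rightarrow> 'n \<Rightarrow> 'n \<Rightarrow> 'n cfun" where
  "hv_curvature D \<alpha> \<mu> \<nu> \<sigma> z =
     pdy \<sigma> (hcoef D \<alpha> \<mu> \<nu>) z - hcov D (vcoef D) \<alpha> \<mu> \<sigma> \<nu> z
     + (\<Sum>\<eta>\<in>UNIV. vcoef D \<alpha> \<mu> \<eta> z * v_hv_torsion D \<eta> \<nu> \<sigma> z)"

definition v_curvature :: "'n::finite finsler_connection \<Rightarrow> 'n \<Rightarrow> 'n \<Rightarrow> 'n \<Rightarrow> 'n \<Rightarrow> 'n cfun" where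
  "v_curvature D \<alpha> \<mu> \<nu> \<sigma> z =
     antisym_diff (\<lambda>\<nu> \<sigma>. pdy \<sigma> (vcoef D \<alpha> \<mu> \<nu>) z
        + (\<Sum>\<eta>\<in>UNIV. vcoef D \<eta> \<mu> \<sigma> z * vcoef D \<alpha> \<eta> \<nu> z)) \<nu> \<sigma>"


section \<open>The geometry of a frame in coordinates\<close>

text \<open>\<open>L i \<alpha>\<close> stands for the components \<open>\<lambda>\<^sub>i\<^sup>\<alpha>\<close> of the \<open>n\<close> sections in the coordinates of a chart,
  and \<open>coframe L i \<mu>\<close> for \<open>\<lambda>\<^sub>i\<^sub>\<mu>\<close>.\<close>

definition coframe :: "('n::finite \<Rightarrow> 'n \<Rightarrow> 'n cfun) \<Rightarrow> 'n \<Rightarrow> 'n \<Rightarrow> 'n cfun" where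
  "coframe L i \<mu> z = matrix_inv (\<chi> \<alpha> i. L i \<alpha> z) $ i $ \<mu>"

definition frame_metric :: "('n::finite \<Rightarrow> 'n \<Rightarrow> 'n cfun) \<Rightarrow> 'n \<Rightarrow> 'n \<Rightarrow> 'n cfun" where
  "frame_metric L \<mu> \<nu> z = (\<Sum>i\<in>UNIV. coframe L i \<mu> z * coframe L i \<nu> z)"

definition frame_metric_inv :: "('n::finite \<Rightarrow> 'n \<Rightarrow> 'n cfun) \<Rightarrow> 'n \<Rightarrow> 'n \<Rightarrow> 'n cfun" where
  "frame_metric_inv L \<mu> \<nu> z = matrix_inv (\<chi> \<mu> \<nu>. frame_metric L \<mu> \<nu> z) $ \<mu> $ \<nu>"

definition christoffel :: "('n::finite \<Rightarrow> 'n \<Rightarrow> 'n cfun) \<Rightarrow> 'n \<Rightarrow> 'n \<Rightarrow> 'n \<Rightarrow> 'n cfun" where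
  "christoffel L \<alpha> \<mu> \<nu> z = 1/2 * (\<Sum>\<eta>\<in>UNIV. frame_metric_inv L \<alpha> \<eta> z *
     (pdx \<mu> (frame_metric L \<nu> \<eta>) z + pdx \<nu> (frame_metric L \<mu> \<eta>) z - pdx \<eta> (frame_metric L \<mu> \<nu>) z))"

definition spray :: "('n::finite \<Rightarrow> 'n \<Rightarrow> 'n cfun) \<Rightarrow> 'n \<Rightarrow> 'n cfun" where
  "spray L \<alpha> z = 1/2 * (\<Sum>\<mu>\<in>UNIV. \<Sum>\<nu>\<in>UNIV. christoffel L \<alpha> \<mu> \<nu> z * snd z $ \<mu> * snd z $ \<nu>)"

definition barthel :: "('n::finite \<Rightarrow> 'n \<Rightarrow> 'n cfun) \<Rightarrow> 'n \<Rightarrow> 'n \<Rightarrow> 'n cfun" where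
  "barthel L \<alpha> \<beta> = pdy \<beta> (spray L \<alpha>)"

definition canonical_connection :: "('n::finite \<Rightarrow> 'n \<Rightarrow> 'n cfun) \<Rightarrow> 'n finsler_connection" where
  "canonical_connection L = \<lparr>
     hcoef = (\<lambda>\<alpha> \<mu> \<nu> z. \<Sum>i\<in>UNIV. L i \<alpha> z * delta (barthel L) \<nu> (coframe L i \<mu>) z),
     nonlin = barthel L,
     vcoef = (\<lambda>\<alpha> \<mu> \<nu> z. \<Sum>i\<in>UNIV. L i \<alpha> z * pdy \<nu> (coframe L i \<mu>) z)\<rparr>"

definition berwald_connection :: "('n::finite \<Rightarrow> 'n \<Rightarrow> 'n cfun) \<Rightarrow> 'n finsler_connection" where
  "berwald_connection L = \<lparr>
     hcoef = (\<lambda>\<alpha> \<mu> \<nu>. pdy \<nu> (barthel L \<alpha> \<mu>)),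
     nonlin = barthel L,
     vcoef = (\<lambda>\<alpha> \<mu> \<nu> z. 0)\<rparr>"


section \<open>FP-spaces\<close>

text \<open>A section of the pullback bundle over the slit tangent bundle maps a point \<open>p\<close> and a nonzero
  tangent vector at \<open>p\<close> to a tangent vector at \<open>p\<close>.\<close>

definition frame_components :: "('a, 'n::finite) chart set \<Rightarrow>
    ('n \<Rightarrow> 'a \<Rightarrow> ('a, 'n) tvec \<Rightarrow> ('a, 'n) tvec) \<Rightarrow> ('a, 'n) chart \<Rightarrow> 'n \<Rightarrow> 'n \<Rightarrow> 'n cfun" where
  "frame_components A lam c i \<alpha> = (\<lambda>(x, y). lam i (cpoint c x) (tvec_of A c (cpoint c x) y) c $ \<alpha>)"

locale FP_space = smooth_manifold M A
  for M :: "'a topology" and A :: "('a, 'n::finite) chart set" +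
  fixes lam :: "'n \<Rightarrow> 'a \<Rightarrow> ('a, 'n) tvec \<Rightarrow> ('a, 'n) tvec"
    and F :: "'a \<Rightarrow> ('a, 'n) tvec \<Rightarrow> real"
  assumes sections: "p \<in> topspace M \<Longrightarrow> v \<in> slit_tangent_space A p \<Longrightarrow> lam i p v \<in> tangent_space A p"
    and smooth_sections: "c \<in> A \<Longrightarrow> smooth_on (cimage c \<times> (- {0})) (frame_components A lam c i \<alpha>)"
    and linearly_independent: "c \<in> A \<Longrightarrow> p \<in> cdom c \<Longrightarrow> v \<in> slit_tangent_space A p \<Longrightarrow>
      inj (\<lambda>i. lam i p v c) \<and> independent (range (\<lambda>i. lam i p v c))"
    and total_symmetry: "c \<in> A \<Longrightarrow> x \<in> cimage c \<Longrightarrow> y \<noteq> 0 \<Longrightarrow>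
      pdy \<alpha> (frame_metric (frame_components A lam c) \<mu> \<nu>) (x, y) =
        pdy \<mu> (frame_metric (frame_components A lam c) \<alpha> \<nu>) (x, y) \<and>
      pdy \<alpha> (frame_metric (frame_components A lam c) \<mu> \<nu>) (x, y) =
        pdy \<alpha> (frame_metric (frame_components A lam c) \<nu> \<mu>) (x, y)"
    and homogeneous: "p \<in> topspace M \<Longrightarrow> v \<in> slit_tangent_space A p \<Longrightarrow> t > 0 \<Longrightarrow>
      lam i p (\<lambda>c. t *\<^sub>R v c) = lam i p v"
    and fundamental_function: "c \<in> A \<Longrightarrow> p \<in> cdom c \<Longrightarrow> v \<in> slit_tangent_space A p \<Longrightarrow>
      F p v = sqrt (\<Sum>\<mu>\<in>UNIV. \<Sum>\<nu>\<in>UNIV.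
        frame_metric (frame_components A lam c) \<mu> \<nu> (cmap c p, v c) * v c $ \<mu> * v c $ \<nu>)"

end

theory Submission
  imports Defs
begin

text \<open>Both halves of the theorem come from comparing the Berwald coefficients \<open>G\<close> with the
  canonical ones: by the definition of the \<open>(v)hv\<close>-torsion, \<open>G = P + \<Gamma>\<close>. This already gives the
  \<open>hv\<close>-curvature, once the summands are known to be differentiable in \<open>y\<close>. The \<open>(h)h\<close>-torsion of the
  Berwald connection vanishes because \<open>G\<^sup>\<alpha>\<^sub>\<mu>\<^sub>\<nu>\<close> is a second \<open>y\<close>-derivative of the spray, so that it is
  symmetric in \<open>\<mu>\<close> and \<open>\<nu>\<close>; the other torsions and the \<open>v\<close>-curvature vanish because the vertical
  coefficients are zero and \<open>G\<close> is the \<open>y\<close>-derivative of \<open>N\<close>.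

  For the \<open>h\<close>-curvature, substitute \<open>G = P + \<Gamma>\<close> in its definition. The terms quadratic in \<open>P\<close> appear as
  they stand; the derivatives of \<open>P\<close> and the mixed products \<open>P\<Gamma>\<close> assemble to the covariant
  derivative of \<open>P\<close>, where the connection term for the third index leaves over, after
  antisymmetrisation, exactly \<open>P T\<close>. What is left are the terms in \<open>\<Gamma>\<close> alone. They would form the
  \<open>h\<close>-curvature of the canonical connection if \<open>C R\<close> were added, and that curvature is zero
  (\<open>canonical_h_curvature_eq_0\<close>), so that they equal \<open>- C R\<close>.

  That curvature vanishes because the coframe is parallel for the canonical connection, that is,
  \<open>\<delta>\<^sub>\<nu> \<lambda>\<^sub>i\<^sub>\<mu> = \<lambda>\<^sub>i\<^sub>\<alpha> \<Gamma>\<^sup>\<alpha>\<^sub>\<mu>\<^sub>\<nu>\<close> and \<open>\<partial>\<^sub>\<nu> \<lambda>\<^sub>i\<^sub>\<mu> = \<lambda>\<^sub>i\<^sub>\<alpha> C\<^sup>\<alpha>\<^sub>\<mu>\<^sub>\<nu>\<close> for the vertical derivative: apply to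
  \<open>\<lambda>\<^sub>i\<^sub>\<mu>\<close> the commutator of two horizontal derivatives, which is a vertical derivative
  with coefficients \<open>- R\<close> (\<open>delta_commutator\<close>).

  The analytic basis of all this is that every object is smooth on the coordinate domain. This starts
  from the frame and is carried through matrix inversion (by Cramer's rule), through sums and products and
  through partial derivatives; mixed partial derivatives then commute by Schwarz's theorem. That the
  frame matrix is invertible at a coordinate pair \<open>(x, y)\<close> needs the pair to come from a nonzero
  tangent vector, which is the chain rule for the transition maps.\<close>

section \<open>Smooth functions on open sets\<close>

lemma k_times_differentiable_on_cong:
  assumes "open S"
  shows "(\<And>x. x \<in> S \<Longrightarrow> f x = g x) \<Longrightarrow> k_times_differentiable_on k S f \<Longrightarrow>
    k_times_differentiable_on k S g"
proof (induction k arbitrary: f g)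
  case 0
  then show ?case by (simp cong: continuous_on_cong)
next
  case (Suc k)
  have g: "(g has_derivative frechet_derivative f (at x)) (at x)" if "x \<in> S" for x
  proof (rule has_derivative_transform_within_open[OF _ assms that])
    show "(f has_derivative frechet_derivative f (at x)) (at x)"
      using Suc.prems(2) that unfolding frechet_derivative_works[symmetric] by simp
  qed (rule Suc.prems(1))
  have "frechet_derivative f (at x) = frechet_derivative g (at x)" if "x \<in> S" for x
    by (rule frechet_derivative_at[OF g[OF that]])
  then have "k_times_differentiable_on k S (\<lambda>x. frechet_derivative g (at x) v)" for v
    using Suc.prems(2) by - (rule Suc.IH[of "\<lambda>x. frechet_derivative f (at x) v"], simp_all)
  moreover have "\<forall>x\<in>S. g differentiable (at x)"
    using g unfolding differentiable_def by blast
  ultimately show ?case by simp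
qed

text \<open>The recursion in the definition of iterated differentiability is phrased with the chosen
  derivative \<open>frechet_derivative\<close>. Here the derivative may be any explicit formula, which is what the
  sum, product and quotient rules provide.\<close>

lemma k_times_differentiable_onI:
  assumes "open S" "\<And>x. x \<in> S \<Longrightarrow> (f has_derivative f' x) (at x)"
    and "\<And>v. k_times_differentiable_on k S (\<lambda>x. f' x v)"
  shows "k_times_differentiable_on (Suc k) S f"
proof -
  have "f' x = frechet_derivative f (at x)" if "x \<in> S" for x
    by (rule frechet_derivative_at) (rule assms(2)[OF that])
  then have "k_times_differentiable_on k S (\<lambda>x. frechet_derivative f (at x) v)" for v
    by - (rule k_times_differentiable_on_cong[OF assms(1) _ assms(3)[of v]], simp)
  moreover have "\<forall>x\<in>S. f differentiable (at x)"
    using assms(2) unfolding differentiable_def by blast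
  ultimately show ?thesis by simp
qed

text \<open>The factors that the product rule leaves undifferentiated only need to be differentiable one
  time less; this lemma lowers the order for them.\<close>

lemma k_times_differentiable_on_Suc_imp:
  "k_times_differentiable_on (Suc k) S f \<Longrightarrow> k_times_differentiable_on k S f"
proof (induction k arbitrary: f)
  case 0
  then show ?case
    by (auto intro!: continuous_at_imp_continuous_on differentiable_imp_continuous_within)
next
  case (Suc k)
  then show ?case by fastforce
qed

lemma k_times_differentiable_on_has_derivative:
  "k_times_differentiable_on (Suc k) S f \<Longrightarrow> x \<in> S \<Longrightarrow>
    (f has_derivative frechet_derivative f (at x)) (at x)"
  unfolding frechet_derivative_works[symmetric] by simp

lemma k_times_differentiable_on_const: "open S \<Longrightarrow> k_times_differentiable_on k S (\<lambda>x. b)"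
proof (induction k arbitrary: b)
  case (Suc k)
  then show ?case by (intro k_times_differentiable_onI[where f' = "\<lambda>x v. 0"]) auto
qed auto

lemma k_times_differentiable_on_add:
  "open S \<Longrightarrow> k_times_differentiable_on k S f \<Longrightarrow> k_times_differentiable_on k S g \<Longrightarrow>
    k_times_differentiable_on k S (\<lambda>x. f x + g x)"
proof (induction k arbitrary: f g)
  case (Suc k)
  note f = k_times_differentiable_on_has_derivative[OF Suc.prems(2)]
    and g = k_times_differentiable_on_has_derivative[OF Suc.prems(3)]
  have "k_times_differentiable_on k S
      (\<lambda>x. frechet_derivative f (at x) v + frechet_derivative g (at x) v)" for v
    using Suc.prems by (intro Suc.IH) auto
  then show ?case
    by - (rule k_times_differentiable_onI[OF Suc.prems(1) has_derivative_add], auto intro: f g)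
qed (auto intro: continuous_on_add)

lemma k_times_differentiable_on_mult:
  fixes f g :: "'a::real_normed_vector \<Rightarrow> real"
  shows "open S \<Longrightarrow> k_times_differentiable_on k S f \<Longrightarrow> k_times_differentiable_on k S g \<Longrightarrow>
    k_times_differentiable_on k S (\<lambda>x. f x * g x)"
proof (induction k arbitrary: f g)
  case (Suc k)
  note f = k_times_differentiable_on_has_derivative[OF Suc.prems(2)]
    and g = k_times_differentiable_on_has_derivative[OF Suc.prems(3)]
  have "k_times_differentiable_on k S
      (\<lambda>x. f x * frechet_derivative g (at x) v + frechet_derivative f (at x) v * g x)" for v
    using Suc.prems k_times_differentiable_on_Suc_imp[OF Suc.prems(2)]
      k_times_differentiable_on_Suc_imp[OF Suc.prems(3)]
    by (intro k_times_differentiable_on_add Suc.IH) auto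
  then show ?case
    by - (rule k_times_differentiable_onI[OF Suc.prems(1) has_derivative_mult], auto intro: f g)
qed (auto intro: continuous_on_mult)

lemma k_times_differentiable_on_inverse:
  fixes f :: "'a::real_normed_vector \<Rightarrow> real"
  assumes "open S" "\<And>x. x \<in> S \<Longrightarrow> f x \<noteq> 0"
  shows "k_times_differentiable_on k S f \<Longrightarrow> k_times_differentiable_on k S (\<lambda>x. inverse (f x))"
proof (induction k)
  case 0
  with assms show ?case by (auto intro: continuous_on_inverse)
next
  case (Suc k)
  note f = k_times_differentiable_on_has_derivative[OF Suc.prems]
  note IH = Suc.IH[OF k_times_differentiable_on_Suc_imp[OF Suc.prems]]
  show ?case
  proof (rule k_times_differentiable_onI[OF assms(1)])
    show "((\<lambda>x. inverse (f x)) has_derivative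
        (\<lambda>v. (- 1) * (inverse (f x) * frechet_derivative f (at x) v * inverse (f x)))) (at x)"
      if "x \<in> S" for x
      using Deriv.has_derivative_inverse[OF assms(2)[OF that] f[OF that]] by simp
    show "k_times_differentiable_on k S
        (\<lambda>x. (- 1) * (inverse (f x) * frechet_derivative f (at x) v * inverse (f x)))" for v
      using Suc.prems
      by (intro k_times_differentiable_on_mult k_times_differentiable_on_const IH assms(1)) auto
  qed
qed

lemma k_times_differentiable_on_bounded_linear:
  assumes "open S" "bounded_linear f"
  shows "k_times_differentiable_on k S f"
proof (cases k)
  case 0
  with assms show ?thesis by (auto intro: linear_continuous_on)
next
  case (Suc l)
  have "k_times_differentiable_on (Suc l) S f"
    by (rule k_times_differentiable_onI[where f' = "\<lambda>_. f"])
      (intro assms bounded_linear_imp_has_derivative k_times_differentiable_on_const)+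
  then show ?thesis by (simp only: Suc)
qed

lemma smooth_on_cong:
  "open S \<Longrightarrow> (\<And>x. x \<in> S \<Longrightarrow> f x = g x) \<Longrightarrow> smooth_on S f \<Longrightarrow> smooth_on S g"
  unfolding smooth_on_def by (blast intro: k_times_differentiable_on_cong)

lemma smooth_on_const: "open S \<Longrightarrow> smooth_on S (\<lambda>x. b)"
  by (simp add: smooth_on_def k_times_differentiable_on_const)

lemma smooth_on_bounded_linear: "open S \<Longrightarrow> bounded_linear f \<Longrightarrow> smooth_on S f"
  by (simp add: smooth_on_def k_times_differentiable_on_bounded_linear)

lemma smooth_on_add:
  "open S \<Longrightarrow> smooth_on S f \<Longrightarrow> smooth_on S g \<Longrightarrow> smooth_on S (\<lambda>x. f x + g x)"
  by (simp add: smooth_on_def k_times_differentiable_on_add)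

lemma smooth_on_mult:
  fixes f g :: "'a::real_normed_vector \<Rightarrow> real"
  shows "open S \<Longrightarrow> smooth_on S f \<Longrightarrow> smooth_on S g \<Longrightarrow> smooth_on S (\<lambda>x. f x * g x)"
  by (simp add: smooth_on_def k_times_differentiable_on_mult)

lemma smooth_on_inverse:
  fixes f :: "'a::real_normed_vector \<Rightarrow> real"
  shows "open S \<Longrightarrow> (\<And>x. x \<in> S \<Longrightarrow> f x \<noteq> 0) \<Longrightarrow> smooth_on S f \<Longrightarrow>
    smooth_on S (\<lambda>x. inverse (f x))"
  by (simp add: smooth_on_def k_times_differentiable_on_inverse)

lemma smooth_on_diff:
  fixes f g :: "'a::real_normed_vector \<Rightarrow> real"
  assumes "open S" "smooth_on S f" "smooth_on S g"
  shows "smooth_on S (\<lambda>x. f x - g x)"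
  using smooth_on_add[OF assms(1,2) smooth_on_mult[OF assms(1) smooth_on_const[OF assms(1)] assms(3)],
      of "- 1"]
  by simp

lemma smooth_on_sum:
  "open S \<Longrightarrow> (\<And>i. i \<in> I \<Longrightarrow> smooth_on S (f i)) \<Longrightarrow> smooth_on S (\<lambda>x. \<Sum>i\<in>I. f i x)"
  by (induction I rule: infinite_finite_induct) (auto intro: smooth_on_const smooth_on_add)

lemma smooth_on_prod:
  fixes f :: "'i \<Rightarrow> 'a::real_normed_vector \<Rightarrow> real"
  shows "open S \<Longrightarrow> (\<And>i. i \<in> I \<Longrightarrow> smooth_on S (f i)) \<Longrightarrow> smooth_on S (\<lambda>x. \<Prod>i\<in>I. f i x)"
  by (induction I rule: infinite_finite_induct) (auto intro: smooth_on_const smooth_on_mult)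

lemma smooth_on_imp_differentiable: "smooth_on S f \<Longrightarrow> x \<in> S \<Longrightarrow> f differentiable (at x)"
  unfolding smooth_on_def by (metis k_times_differentiable_on.simps(2))

lemma smooth_on_imp_continuous_on: "smooth_on S f \<Longrightarrow> continuous_on S f"
  unfolding smooth_on_def by (metis k_times_differentiable_on.simps(1))

lemma smooth_on_frechet_derivative:
  "smooth_on S f \<Longrightarrow> smooth_on S (\<lambda>x. frechet_derivative f (at x) v)"
  unfolding smooth_on_def by (metis k_times_differentiable_on.simps(2))

lemma smooth_on_det:
  fixes f :: "'n::finite \<Rightarrow> 'n \<Rightarrow> 'a::real_normed_vector \<Rightarrow> real"
  assumes "open S" "\<And>i j. smooth_on S (f i j)"
  shows "smooth_on S (\<lambda>x. det (\<chi> i j. f i j x))"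
  unfolding det_def
  by (auto intro!: smooth_on_sum smooth_on_mult smooth_on_const smooth_on_prod assms)

lemma matrix_inv_mult:
  fixes A :: "real^'n^'n"
  assumes "invertible A"
  shows "A ** matrix_inv A = mat 1" "matrix_inv A ** A = mat 1"
  using someI_ex[OF assms[unfolded invertible_def]] unfolding matrix_inv_def by auto

text \<open>By Cramer's rule the entries of the inverse are quotients of determinants, hence rational functions of
  the entries. This makes inversion a smooth operation.\<close>

lemma matrix_inv_cramer:
  fixes A :: "real^'n^'n"
  assumes "invertible A"
  shows "matrix_inv A $ k $ m =
    det (\<chi> i j. if j = k then (if i = m then 1 else 0) else A $ i $ j) * inverse (det A)"
proof -
  have "A *v (matrix_inv A *v axis m 1) = axis m 1"
    by (simp add: matrix_vector_mul_assoc matrix_inv_mult[OF assms])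
  then have "matrix_inv A *v axis m 1 = (\<chi> k. det (\<chi> i j. if j = k then axis m 1 $ i else A $ i $ j) / det A)"
    using cramer[of A "matrix_inv A *v axis m 1" "axis m 1"] assms by (simp add: invertible_det_nz)
  then have "(matrix_inv A *v axis m 1) $ k = det (\<chi> i j. if j = k then axis m 1 $ i else A $ i $ j) / det A"
    by simp
  moreover have "(matrix_inv A *v axis m 1) $ k = matrix_inv A $ k $ m"
    by (simp add: matrix_vector_mul_component inner_axis)
  ultimately show ?thesis
    by (simp add: axis_def divide_inverse cong: if_cong)
qed

lemma smooth_on_matrix_inv:
  fixes f :: "'n::finite \<Rightarrow> 'n \<Rightarrow> 'a::real_normed_vector \<Rightarrow> real"
  assumes "open S" "\<And>i j. smooth_on S (f i j)" "\<And>x. x \<in> S \<Longrightarrow> invertible (\<chi> i j. f i j x)"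
  shows "smooth_on S (\<lambda>x. matrix_inv (\<chi> i j. f i j x) $ k $ m)"
proof -
  have "smooth_on S (\<lambda>x. det (\<chi> i j. if j = k then (if i = m then 1 else 0) else f i j x)
      * inverse (det (\<chi> i j. f i j x)))"
  proof (intro smooth_on_mult smooth_on_inverse smooth_on_det assms(1,2))
    show "smooth_on S (\<lambda>x. if j = k then (if i = m then 1 else 0) else f i j x)" for i j
      using assms(1,2) by (cases "j = k") (auto intro: smooth_on_const)
  qed (use assms(3) in \<open>simp add: invertible_det_nz\<close>)
  then show ?thesis
    by (rule smooth_on_cong[OF assms(1), rotated]) (simp add: matrix_inv_cramer[OF assms(3)] cong: if_cong)
qed

section \<open>Commuting second derivatives\<close>

lemma has_real_derivative_along_line:
  fixes f :: "'a::real_normed_vector \<Rightarrow> real"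
  assumes "f differentiable (at (a + t *\<^sub>R u))"
  shows "((\<lambda>t. f (a + t *\<^sub>R u)) has_real_derivative frechet_derivative f (at (a + t *\<^sub>R u)) u) (at t)"
proof -
  let ?D = "frechet_derivative f (at (a + t *\<^sub>R u))"
  have D: "(f has_derivative ?D) (at (a + t *\<^sub>R u))"
    using assms by (simp add: frechet_derivative_works)
  have "((\<lambda>t. a + t *\<^sub>R u) has_derivative (\<lambda>s. s *\<^sub>R u)) (at t)"
    by (auto intro!: derivative_eq_intros)
  from has_derivative_compose[OF this D]
  have "((\<lambda>t. f (a + t *\<^sub>R u)) has_derivative (\<lambda>s. ?D (s *\<^sub>R u))) (at t)" .
  moreover have "(\<lambda>s. ?D (s *\<^sub>R u)) = (*) (?D u)"
    using linear_frechet_derivative[OF assms] by (auto simp: linear_cmul)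
  ultimately show ?thesis by (simp add: has_field_derivative_def)
qed

text \<open>The mean value theorem, used once in direction \<open>u\<close> and once in direction \<open>v\<close>, turns the second
  difference over a parallelogram into a mixed second derivative at a nearby point. Since
  the second difference is symmetric in \<open>u\<close> and \<open>v\<close>, the two orders of differentiation can be compared.\<close>

lemma second_difference_mean_value:
  fixes f :: "'a::real_normed_vector \<Rightarrow> real"
  assumes "ball z r \<subseteq> S" "0 < h" "h * (norm u + norm v) < r"
    and f: "\<And>x. x \<in> S \<Longrightarrow> f differentiable (at x)"
    and fu: "\<And>x. x \<in> S \<Longrightarrow> (\<lambda>x. frechet_derivative f (at x) u) differentiable (at x)"
  obtains p where "p \<in> ball z r"
    "f (z + h *\<^sub>R u + h *\<^sub>R v) - f (z + h *\<^sub>R u) - f (z + h *\<^sub>R v) + f z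
      = h * h * frechet_derivative (\<lambda>x. frechet_derivative f (at x) u) (at p) v"
proof -
  let ?fu = "\<lambda>x. frechet_derivative f (at x) u"
  have mem: "z + s *\<^sub>R u + t *\<^sub>R v \<in> ball z r" if "0 \<le> s" "s \<le> h" "0 \<le> t" "t \<le> h" for s t
  proof -
    have "norm (s *\<^sub>R u + t *\<^sub>R v) \<le> s * norm u + t * norm v"
      using that by (intro order_trans[OF norm_triangle_ineq]) simp
    also have "\<dots> \<le> h * norm u + h * norm v"
      using that by (intro add_mono mult_right_mono) auto
    also have "\<dots> < r" using assms(3) by (simp add: algebra_simps)
    finally have "norm (s *\<^sub>R u + t *\<^sub>R v) < r" .
    moreover have "dist z (z + s *\<^sub>R u + t *\<^sub>R v) = norm (s *\<^sub>R u + t *\<^sub>R v)"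
      by (simp only: dist_norm norm_minus_commute[of z] add.assoc add_diff_cancel_left')
    ultimately show ?thesis by simp
  qed
  define \<phi> where "\<phi> = (\<lambda>s. f ((z + h *\<^sub>R v) + s *\<^sub>R u) - f (z + s *\<^sub>R u))"
  have "(\<phi> has_real_derivative ?fu ((z + h *\<^sub>R v) + s *\<^sub>R u) - ?fu (z + s *\<^sub>R u)) (at s)"
    if "0 \<le> s" "s \<le> h" for s
    unfolding \<phi>_def using mem[OF that, of h] mem[OF that, of 0] assms(1,2) f
    by (intro DERIV_diff has_real_derivative_along_line)
      (auto simp: algebra_simps subset_iff simp del: mem_ball)
  from MVT2[OF assms(2) this]
  obtain \<xi> where \<xi>: "0 < \<xi>" "\<xi> < h"
    "\<phi> h - \<phi> 0 = h * (?fu ((z + h *\<^sub>R v) + \<xi> *\<^sub>R u) - ?fu (z + \<xi> *\<^sub>R u))"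
    by auto
  have "((\<lambda>t. ?fu ((z + \<xi> *\<^sub>R u) + t *\<^sub>R v)) has_real_derivative
      frechet_derivative ?fu (at ((z + \<xi> *\<^sub>R u) + t *\<^sub>R v)) v) (at t)" if "0 \<le> t" "t \<le> h" for t
    using mem[OF _ _ that, of \<xi>] \<xi> assms(1) fu
    by (intro has_real_derivative_along_line) (auto simp: algebra_simps subset_iff simp del: mem_ball)
  from MVT2[OF assms(2) this]
  obtain \<eta> where \<eta>: "0 < \<eta>" "\<eta> < h"
    "?fu ((z + \<xi> *\<^sub>R u) + h *\<^sub>R v) - ?fu (z + \<xi> *\<^sub>R u)
      = h * frechet_derivative ?fu (at ((z + \<xi> *\<^sub>R u) + \<eta> *\<^sub>R v)) v"
    by auto
  show thesis
  proof (rule that)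
    show "z + \<xi> *\<^sub>R u + \<eta> *\<^sub>R v \<in> ball z r" using \<xi> \<eta> by (intro mem) auto
    show "f (z + h *\<^sub>R u + h *\<^sub>R v) - f (z + h *\<^sub>R u) - f (z + h *\<^sub>R v) + f z
      = h * h * frechet_derivative ?fu (at (z + \<xi> *\<^sub>R u + \<eta> *\<^sub>R v)) v"
      using \<xi>(3) \<eta>(3) by (simp add: \<phi>_def add_ac mult.assoc)
  qed
qed

text \<open>Schwarz's theorem. For a small parallelogram at \<open>z\<close>, the second difference divided by \<open>h\<^sup>2\<close> is a value of
  either mixed derivative, each at a point of its own near \<open>z\<close>; by continuity the values at \<open>z\<close> agree.\<close>

lemma second_frechet_derivative_commute:
  fixes f :: "'a::real_normed_vector \<Rightarrow> real"
  assumes "open S" "z \<in> S" "smooth_on S f"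
  shows "frechet_derivative (\<lambda>x. frechet_derivative f (at x) u) (at z) v
    = frechet_derivative (\<lambda>x. frechet_derivative f (at x) v) (at z) u" (is "?A z = ?B z")
proof (rule ccontr)
  assume "?A z \<noteq> ?B z"
  define \<epsilon> where "\<epsilon> = \<bar>?A z - ?B z\<bar> / 2"
  have "\<epsilon> > 0" using \<open>?A z \<noteq> ?B z\<close> by (simp add: \<epsilon>_def)
  have "continuous_on S ?A" "continuous_on S ?B"
    by (intro smooth_on_imp_continuous_on smooth_on_frechet_derivative assms(3))+
  then have "continuous (at z) ?A" "continuous (at z) ?B"
    using assms(1,2) by (auto simp: continuous_on_eq_continuous_at)
  then obtain d1 d2 where d: "d1 > 0" "d2 > 0"
    "\<And>p. dist p z < d1 \<Longrightarrow> dist (?A p) (?A z) < \<epsilon>" "\<And>p. dist p z < d2 \<Longrightarrow> dist (?B p) (?B z) < \<epsilon>"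
    using \<open>\<epsilon> > 0\<close> unfolding continuous_at_eps_delta by metis
  obtain d3 where d3: "d3 > 0" "ball z d3 \<subseteq> S" using assms(1,2) by (auto simp: open_contains_ball)
  define r where "r = min d1 (min d2 d3)"
  have r: "r > 0" "ball z r \<subseteq> S" using d d3 by (auto simp: r_def)
  \<comment> \<open>The parallelogram with sides \<open>h u\<close> and \<open>h v\<close> lies in the ball; the summand \<open>1\<close> keeps the
    denominator positive when \<open>u = v = 0\<close>.\<close>
  define h where "h = r / (2 * (norm u + norm v + 1))"
  have "norm u + norm v + 1 > 0" by (simp add: add_nonneg_pos)
  then have h: "h > 0" "h * (norm u + norm v + 1) = r / 2" using r by (auto simp: h_def field_simps)
  then have h': "h * (norm u + norm v) < r" "h * (norm v + norm u) < r" 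
    using r by (auto simp: algebra_simps)
  have diff: "x \<in> S \<Longrightarrow> f differentiable (at x)"
    "x \<in> S \<Longrightarrow> (\<lambda>x. frechet_derivative f (at x) w) differentiable (at x)" for x w
    using assms(3) by (auto intro: smooth_on_imp_differentiable smooth_on_frechet_derivative)
  obtain p where p: "p \<in> ball z r"
    "f (z + h *\<^sub>R u + h *\<^sub>R v) - f (z + h *\<^sub>R u) - f (z + h *\<^sub>R v) + f z = h * h * ?A p"
    by (rule second_difference_mean_value[OF r(2) h(1) h'(1) diff])
  obtain q where q: "q \<in> ball z r"
    "f (z + h *\<^sub>R v + h *\<^sub>R u) - f (z + h *\<^sub>R v) - f (z + h *\<^sub>R u) + f z = h * h * ?B q"
    by (rule second_difference_mean_value[OF r(2) h(1) h'(2) diff])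
  have "h * h * ?A p = h * h * ?B q"
    using p(2) q(2) by (simp add: add_ac diff_diff_eq)
  then have "?A p = ?B q" using h(1) by simp
  moreover have "dist (?A p) (?A z) < \<epsilon>" "dist (?B q) (?B z) < \<epsilon>"
    using p q by (auto intro!: d simp: r_def dist_commute)
  ultimately show False unfolding \<epsilon>_def dist_real_def by argo
qed

section \<open>Coordinate and horizontal derivatives\<close>

lemma frechet_derivative_diff:
  "f differentiable (at z) \<Longrightarrow> g differentiable (at z) \<Longrightarrow>
    frechet_derivative (\<lambda>z. f z - g z) (at z) v = frechet_derivative f (at z) v - frechet_derivative g (at z) v"
  unfolding frechet_derivative_works
  by (rule frechet_derivative_at[THEN fun_cong, symmetric]) (rule has_derivative_diff)

lemma frechet_derivative_mult:
  fixes f g :: "'a::real_normed_vector \<Rightarrow> real"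
  shows "f differentiable (at z) \<Longrightarrow> g differentiable (at z) \<Longrightarrow>
    frechet_derivative (\<lambda>z. f z * g z) (at z) v = f z * frechet_derivative g (at z) v + frechet_derivative f (at z) v * g z"
  unfolding frechet_derivative_works
  by (rule frechet_derivative_at[THEN fun_cong, symmetric]) (rule has_derivative_mult)

lemma frechet_derivative_sum:
  "(\<And>i. i \<in> I \<Longrightarrow> f i differentiable (at z)) \<Longrightarrow>
    frechet_derivative (\<lambda>z. \<Sum>i\<in>I. f i z) (at z) v = (\<Sum>i\<in>I. frechet_derivative (f i) (at z) v)"
  unfolding frechet_derivative_works
  by (rule frechet_derivative_at[THEN fun_cong, symmetric]) (rule has_derivative_sum)

lemma pdx_eq_frechet_derivative:
  assumes "f differentiable (at z)"
  shows "pdx \<mu> f z = frechet_derivative f (at z) (axis \<mu> 1, 0)"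
  using has_real_derivative_along_line[of f z 0 "(axis \<mu> 1, 0)"] assms
  by (cases z) (simp add: pdx_def DERIV_imp_deriv)

lemma pdy_eq_frechet_derivative:
  assumes "f differentiable (at z)"
  shows "pdy \<mu> f z = frechet_derivative f (at z) (0, axis \<mu> 1)"
  using has_real_derivative_along_line[of f z 0 "(0, axis \<mu> 1)"] assms
  by (cases z) (simp add: pdy_def DERIV_imp_deriv)

text \<open>At a fixed point the horizontal derivative is a directional derivative, along the horizontal lift of the
  \<open>\<mu>\<close>-th coordinate vector. So it inherits the sum and product rules of the total derivative.\<close>

lemma delta_eq_frechet_derivative:
  assumes "f differentiable (at z)"
  shows "delta N \<mu> f z = frechet_derivative f (at z) (axis \<mu> 1, - (\<chi> \<alpha>. N \<alpha> \<mu> z))"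
proof -
  let ?D = "frechet_derivative f (at z)"
  interpret linear ?D by (rule linear_frechet_derivative[OF assms])
  have direction: "(axis \<mu> 1, - (\<chi> \<alpha>. N \<alpha> \<mu> z)) = (axis \<mu> 1, 0) - (\<Sum>\<alpha>\<in>UNIV. N \<alpha> \<mu> z *\<^sub>R (0, axis \<alpha> 1))"
    by (auto simp: prod_eq_iff fst_sum snd_sum vec_eq_iff axis_def if_distrib sum.delta cong: if_cong)
  show ?thesis
    unfolding direction diff sum scale real_scaleR_def delta_def
      pdx_eq_frechet_derivative[OF assms] pdy_eq_frechet_derivative[OF assms] ..
qed

lemma smooth_on_pdx: "open S \<Longrightarrow> smooth_on S f \<Longrightarrow> smooth_on S (pdx \<mu> f)"
  by (rule smooth_on_cong[OF _ _ smooth_on_frechet_derivative])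
    (auto simp: pdx_eq_frechet_derivative smooth_on_imp_differentiable)

lemma smooth_on_pdy: "open S \<Longrightarrow> smooth_on S f \<Longrightarrow> smooth_on S (pdy \<mu> f)"
  by (rule smooth_on_cong[OF _ _ smooth_on_frechet_derivative])
    (auto simp: pdy_eq_frechet_derivative smooth_on_imp_differentiable)

lemma smooth_on_delta:
  "open S \<Longrightarrow> (\<And>\<alpha>. smooth_on S (N \<alpha> \<mu>)) \<Longrightarrow> smooth_on S f \<Longrightarrow> smooth_on S (delta N \<mu> f)"
  unfolding delta_def
  by (intro smooth_on_diff smooth_on_sum smooth_on_mult smooth_on_pdx smooth_on_pdy)

lemma frechet_derivative_cong_open:
  assumes "open S" "z \<in> S" "\<And>z. z \<in> S \<Longrightarrow> f z = g z" "f differentiable (at z)"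
  shows "frechet_derivative f (at z) = frechet_derivative g (at z)"
  using assms frechet_derivative_transform_within_open by blast

lemma delta_cong:
  assumes "open S" "z \<in> S" "\<And>z. z \<in> S \<Longrightarrow> f z = g z" "smooth_on S f"
  shows "delta N \<mu> f z = delta N \<mu> g z"
proof -
  have "smooth_on S g" by (rule smooth_on_cong[OF assms(1,3,4)])
  with assms show ?thesis
    using frechet_derivative_cong_open[OF assms(1,2,3)]
    by (simp add: delta_eq_frechet_derivative smooth_on_imp_differentiable)
qed

lemma partial_derivatives_commute:
  assumes "open S" "z \<in> S" "smooth_on S f"
  shows "pdx \<mu> (pdx \<nu> f) z = pdx \<nu> (pdx \<mu> f) z"
    and "pdx \<mu> (pdy \<nu> f) z = pdy \<nu> (pdx \<mu> f) z"
    and "pdy \<mu> (pdy \<nu> f) z = pdy \<nu> (pdy \<mu> f) z"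
proof -
  have f: "w \<in> S \<Longrightarrow> f differentiable (at w)" for w
    using assms(3) by (rule smooth_on_imp_differentiable)
  have d: "pdx \<kappa> f differentiable (at z)" "pdy \<kappa> f differentiable (at z)" for \<kappa>
    using assms by (auto intro!: smooth_on_imp_differentiable smooth_on_pdx smooth_on_pdy)
  have x: "frechet_derivative (pdx \<kappa> f) (at z)
      = frechet_derivative (\<lambda>w. frechet_derivative f (at w) (axis \<kappa> 1, 0)) (at z)" for \<kappa>
    by (rule frechet_derivative_cong_open[OF assms(1,2) _ d(1)]) (simp add: pdx_eq_frechet_derivative f)
  have y: "frechet_derivative (pdy \<kappa> f) (at z)
      = frechet_derivative (\<lambda>w. frechet_derivative f (at w) (0, axis \<kappa> 1)) (at z)" for \<kappa>
    by (rule frechet_derivative_cong_open[OF assms(1,2) _ d(2)]) (simp add: pdy_eq_frechet_derivative f)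
  note * = pdx_eq_frechet_derivative[OF d(1)] pdx_eq_frechet_derivative[OF d(2)]
    pdy_eq_frechet_derivative[OF d(1)] pdy_eq_frechet_derivative[OF d(2)] x y
  show "pdx \<mu> (pdx \<nu> f) z = pdx \<nu> (pdx \<mu> f) z" "pdx \<mu> (pdy \<nu> f) z = pdy \<nu> (pdx \<mu> f) z"
    "pdy \<mu> (pdy \<nu> f) z = pdy \<nu> (pdy \<mu> f) z"
    unfolding * by (rule second_frechet_derivative_commute[OF assms])+
qed

text \<open>The second order terms of \<open>\<delta>\<^sub>\<sigma> \<delta>\<^sub>\<nu> f\<close> are symmetric in \<open>\<sigma>\<close> and \<open>\<nu>\<close> because partial derivatives
  commute. Only the terms survive in which \<open>\<delta>\<close> differentiates the coefficients \<open>N\<close>; their antisymmetric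
  part is the curvature \<open>R\<close> of the nonlinear connection.\<close>

lemma delta_commutator:
  assumes "open S" "z \<in> S" "smooth_on S f" and N: "\<And>\<alpha> \<mu>. smooth_on S (N \<alpha> \<mu>)"
  shows "delta N \<sigma> (delta N \<nu> f) z - delta N \<nu> (delta N \<sigma> f) z
    = - (\<Sum>\<alpha>\<in>UNIV. (delta N \<sigma> (N \<alpha> \<nu>) z - delta N \<nu> (N \<alpha> \<sigma>) z) * pdy \<alpha> f z)"
proof -
  note smooth = smooth_on_mult smooth_on_sum smooth_on_pdx smooth_on_pdy N assms(1,3)
  have diff [simp]: "g differentiable (at z)" if "smooth_on S g" for g
    using that assms(2) by (rule smooth_on_imp_differentiable)
  \<comment> \<open>The bracket collects the part that is symmetric in \<open>\<kappa>\<close> and \<open>\<rho>\<close>.\<close>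
  have expand: "delta N \<kappa> (delta N \<rho> f) z =
      (pdx \<kappa> (pdx \<rho> f) z - (\<Sum>\<beta>\<in>UNIV. N \<beta> \<kappa> z * pdy \<beta> (pdx \<rho> f) z)
        - (\<Sum>\<alpha>\<in>UNIV. N \<alpha> \<rho> z * pdx \<kappa> (pdy \<alpha> f) z)
        + (\<Sum>\<alpha>\<in>UNIV. \<Sum>\<beta>\<in>UNIV. N \<alpha> \<rho> z * N \<beta> \<kappa> z * pdy \<beta> (pdy \<alpha> f) z))
      - (\<Sum>\<alpha>\<in>UNIV. delta N \<kappa> (N \<alpha> \<rho>) z * pdy \<alpha> f z)" for \<kappa> \<rho>
  proof -
    have delta_f: "delta N \<rho> f = (\<lambda>w. pdx \<rho> f w - (\<Sum>\<alpha>\<in>UNIV. N \<alpha> \<rho> w * pdy \<alpha> f w))"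
      by (simp add: delta_def fun_eq_iff)
    have smN: "smooth_on S (\<lambda>w. N \<alpha> \<rho> w * pdy \<alpha> f w)" for \<alpha> by (intro smooth)
    have "smooth_on S (\<lambda>w. pdx \<rho> f w - (\<Sum>\<alpha>\<in>UNIV. N \<alpha> \<rho> w * pdy \<alpha> f w))"
      by (intro smooth_on_diff smooth)
    moreover have "smooth_on S (\<lambda>w. \<Sum>\<alpha>\<in>UNIV. N \<alpha> \<rho> w * pdy \<alpha> f w)" by (intro smooth)
    moreover have "smooth_on S (pdx \<rho> f)" "\<And>\<alpha>. smooth_on S (pdy \<alpha> f)" by (intro smooth)+
    ultimately have "delta N \<kappa> (delta N \<rho> f) z = delta N \<kappa> (pdx \<rho> f) z
        - (\<Sum>\<alpha>\<in>UNIV. N \<alpha> \<rho> z * delta N \<kappa> (pdy \<alpha> f) z + delta N \<kappa> (N \<alpha> \<rho>) z * pdy \<alpha> f z)"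
      unfolding delta_f using smN N
      by (simp add: delta_eq_frechet_derivative frechet_derivative_diff frechet_derivative_mult
          frechet_derivative_sum)
    then show ?thesis
      by (simp add: delta_def[of N \<kappa> "pdx \<rho> f"] delta_def[of N \<kappa> "pdy _ f"] sum.distrib
          sum_subtractf right_diff_distrib sum_distrib_left mult.assoc)
  qed
  have "(\<Sum>\<alpha>\<in>UNIV. \<Sum>\<beta>\<in>UNIV. N \<alpha> \<nu> z * N \<beta> \<sigma> z * pdy \<beta> (pdy \<alpha> f) z)
      = (\<Sum>\<alpha>\<in>UNIV. \<Sum>\<beta>\<in>UNIV. N \<alpha> \<sigma> z * N \<beta> \<nu> z * pdy \<beta> (pdy \<alpha> f) z)"
    by (subst sum.swap) (intro sum.cong refl, simp add: partial_derivatives_commute(3)[OF assms(1-3)] mult_ac)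
  then show ?thesis
    unfolding expand
    by (simp add: partial_derivatives_commute(1)[OF assms(1-3), of \<sigma> \<nu>]
        partial_derivatives_commute(2)[OF assms(1-3)] left_diff_distrib sum_subtractf)
qed

section \<open>The geometry of a smooth frame in coordinates\<close>

text \<open>The components of a frame over an open set of coordinate pairs \<open>(x, y)\<close>, as a single chart sees
  them. The curvature identities are local, so they are proved here, by calculus on \<open>\<real>\<^sup>n \<times> \<real>\<^sup>n\<close>.\<close>

locale smooth_frame =
  fixes L :: "'n::finite \<Rightarrow> 'n \<Rightarrow> 'n cfun" and S :: "((real^'n) \<times> (real^'n)) set"
  assumes open_domain: "open S"
    and smooth_frame: "\<And>i \<alpha>. smooth_on S (L i \<alpha>)"
    and invertible_frame: "\<And>z. z \<in> S \<Longrightarrow> invertible (\<chi> \<alpha> i. L i \<alpha> z)"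
begin

lemma frame_coframe:
  assumes "z \<in> S"
  shows "(\<Sum>\<alpha>\<in>UNIV. coframe L i \<alpha> z * L j \<alpha> z) = (if i = j then 1 else 0)"
proof -
  have "(matrix_inv (\<chi> \<alpha> i. L i \<alpha> z) ** (\<chi> \<alpha> i. L i \<alpha> z)) $ i $ j = mat 1 $ i $ j"
    by (simp only: matrix_inv_mult[OF invertible_frame[OF assms]])
  then show ?thesis by (simp add: matrix_matrix_mult_def coframe_def mat_def)
qed

text \<open>The metric is \<open>B\<^sup>T B\<close> for the matrix \<open>B\<close> of the coframe.\<close>

lemma invertible_frame_metric:
  assumes "z \<in> S"
  shows "invertible (\<chi> \<mu> \<nu>. frame_metric L \<mu> \<nu> z)"
proof -
  let ?B = "matrix_inv (\<chi> \<alpha> i. L i \<alpha> z)"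
  have "(\<chi> \<mu> \<nu>. frame_metric L \<mu> \<nu> z) = transpose ?B ** ?B"
    by (simp add: vec_eq_iff frame_metric_def coframe_def transpose_def matrix_matrix_mult_def)
  moreover have "invertible ?B"
    using matrix_inv_mult[OF invertible_frame[OF assms]] by (auto simp: invertible_def)
  ultimately show ?thesis by (simp add: invertible_mult transpose_invertible)
qed

lemma smooth_coframe: "smooth_on S (coframe L i \<mu>)"
  unfolding coframe_def[abs_def]
  by (rule smooth_on_matrix_inv[OF open_domain smooth_frame invertible_frame])

lemma smooth_frame_metric: "smooth_on S (frame_metric L \<mu> \<nu>)"
  unfolding frame_metric_def[abs_def]
  by (intro smooth_on_sum smooth_on_mult smooth_coframe open_domain)

lemma smooth_frame_metric_inv: "smooth_on S (frame_metric_inv L \<mu> \<nu>)"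
  unfolding frame_metric_inv_def[abs_def]
  by (rule smooth_on_matrix_inv[OF open_domain smooth_frame_metric invertible_frame_metric])

lemma smooth_christoffel: "smooth_on S (christoffel L \<alpha> \<mu> \<nu>)"
  unfolding christoffel_def[abs_def]
  by (intro smooth_on_sum smooth_on_mult smooth_on_add smooth_on_diff smooth_on_const smooth_on_pdx
      smooth_frame_metric smooth_frame_metric_inv open_domain)

lemma smooth_spray: "smooth_on S (spray L \<alpha>)"
proof -
  have "smooth_on S (\<lambda>z. snd z $ \<mu>)" for \<mu>
    by (intro smooth_on_bounded_linear open_domain bounded_linear_compose[OF bounded_linear_vec_nth bounded_linear_snd])
  then show ?thesis
    unfolding spray_def[abs_def]
    by (intro smooth_on_sum smooth_on_mult smooth_on_const smooth_christoffel open_domain)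
qed

lemma smooth_barthel: "smooth_on S (barthel L \<alpha> \<mu>)"
  unfolding barthel_def by (intro smooth_on_pdy smooth_spray open_domain)

lemma smooth_canonical_hcoef: "smooth_on S (hcoef (canonical_connection L) \<alpha> \<mu> \<nu>)"
  unfolding canonical_connection_def finsler_connection.simps
  by (intro smooth_on_sum smooth_on_mult smooth_frame smooth_on_delta smooth_barthel smooth_coframe
      open_domain)

lemma coframe_inverse_expansion:
  assumes "z \<in> S"
  shows "(\<Sum>\<alpha>\<in>UNIV. coframe L i \<alpha> z * (\<Sum>j\<in>UNIV. L j \<alpha> z * d j)) = d i"
proof -
  have "(\<Sum>\<alpha>\<in>UNIV. coframe L i \<alpha> z * (\<Sum>j\<in>UNIV. L j \<alpha> z * d j))
      = (\<Sum>j\<in>UNIV. (\<Sum>\<alpha>\<in>UNIV. coframe L i \<alpha> z * L j \<alpha> z) * d j)"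
    unfolding sum_distrib_left sum_distrib_right mult.assoc by (rule sum.swap)
  also have "\<dots> = (\<Sum>j\<in>UNIV. (if i = j then 1 else 0) * d j)"
    by (simp only: frame_coframe[OF assms])
  finally show ?thesis by (simp add: mult_delta_left)
qed

text \<open>The coframe is a basis of the covectors, so a component vector on which all its members vanish is zero.
  This turns identities contracted with \<open>\<lambda>\<^sub>i\<^sub>\<beta>\<close> into identities with a free upper index.\<close>

lemma coframe_separates:
  assumes "z \<in> S" "\<And>i. (\<Sum>\<beta>\<in>UNIV. coframe L i \<beta> z * X \<beta>) = 0"
  shows "X \<alpha> = 0"
proof -
  let ?A = "\<chi> \<alpha> i. L i \<alpha> z"
  have "matrix_inv ?A *v (\<chi> \<beta>. X \<beta>) = 0"
    using assms(2) by (simp add: vec_eq_iff matrix_vector_mult_def coframe_def)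
  then have "?A *v (matrix_inv ?A *v (\<chi> \<beta>. X \<beta>)) = 0" by simp
  then show ?thesis
    by (simp add: matrix_vector_mul_assoc matrix_inv_mult[OF invertible_frame[OF assms(1)]] vec_eq_iff
        del: matrix_vector_mult_0_right)
qed

abbreviation "N \<equiv> barthel L"
abbreviation "\<Gamma> \<equiv> hcoef (canonical_connection L)"
abbreviation "C \<equiv> vcoef (canonical_connection L)"
abbreviation "P \<equiv> v_hv_torsion (canonical_connection L)"
abbreviation "G \<equiv> hcoef (berwald_connection L)"

lemma nonlin_connections [simp]:
  "nonlin (canonical_connection L) = N" "nonlin (berwald_connection L) = N"
  by (simp_all add: canonical_connection_def berwald_connection_def)

lemma delta_coframe:
  assumes "z \<in> S"
  shows "delta N \<nu> (coframe L i \<mu>) z = (\<Sum>\<alpha>\<in>UNIV. coframe L i \<alpha> z * \<Gamma> \<alpha> \<mu> \<nu> z)"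
  by (simp add: canonical_connection_def coframe_inverse_expansion[OF assms])

lemma pdy_coframe:
  assumes "z \<in> S"
  shows "pdy \<nu> (coframe L i \<mu>) z = (\<Sum>\<alpha>\<in>UNIV. coframe L i \<alpha> z * C \<alpha> \<mu> \<nu> z)"
  by (simp add: canonical_connection_def coframe_inverse_expansion[OF assms])

text \<open>Differentiating \<open>\<delta>\<^sub>\<nu> \<lambda>\<^sub>i\<^sub>\<mu> = \<lambda>\<^sub>i\<^sub>\<alpha> \<Gamma>\<^sup>\<alpha>\<^sub>\<mu>\<^sub>\<nu>\<close> once more gives
  \<open>\<delta>\<^sub>\<sigma> \<delta>\<^sub>\<nu> \<lambda>\<^sub>i\<^sub>\<mu> = \<lambda>\<^sub>i\<^sub>\<beta> (\<delta>\<^sub>\<sigma> \<Gamma>\<^sup>\<beta>\<^sub>\<mu>\<^sub>\<nu> + \<Gamma>\<^sup>\<eta>\<^sub>\<mu>\<^sub>\<nu> \<Gamma>\<^sup>\<beta>\<^sub>\<eta>\<^sub>\<sigma>)\<close>, the expression that is antisymmetrised in the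
  curvature. By the commutator formula its antisymmetric part is minus the contraction of \<open>R\<close> with the
  vertical derivatives of \<open>\<lambda>\<^sub>i\<^sub>\<mu>\<close>, and this cancels the term \<open>C R\<close> of the curvature.\<close>

lemma canonical_h_curvature_eq_0:
  assumes "z \<in> S"
  shows "h_curvature (canonical_connection L) \<alpha> \<mu> \<nu> \<sigma> z = 0"
proof (rule coframe_separates[OF assms, where X = "\<lambda>\<beta>. h_curvature (canonical_connection L) \<beta> \<mu> \<nu> \<sigma> z"])
  fix i
  have diff: "f differentiable (at z)" if "smooth_on S f" for f :: "'n cfun"
    using that assms by (rule smooth_on_imp_differentiable)
  have second: "delta N \<tau> (delta N \<kappa> (coframe L i \<mu>)) z =
      (\<Sum>\<beta>\<in>UNIV. coframe L i \<beta> z *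
        (delta N \<tau> (\<Gamma> \<beta> \<mu> \<kappa>) z + (\<Sum>\<eta>\<in>UNIV. \<Gamma> \<eta> \<mu> \<kappa> z * \<Gamma> \<beta> \<eta> \<tau> z)))" for \<kappa> \<tau>
  proof -
    have smooth_prod: "smooth_on S (\<lambda>w. coframe L i \<beta> w * \<Gamma> \<beta> \<mu> \<kappa> w)" for \<beta>
      by (intro smooth_on_mult smooth_coframe smooth_canonical_hcoef open_domain)
    have smooth_total: "smooth_on S (\<lambda>w. \<Sum>\<beta>\<in>UNIV. coframe L i \<beta> w * \<Gamma> \<beta> \<mu> \<kappa> w)"
      by (intro smooth_on_sum smooth_prod open_domain)
    have "delta N \<tau> (delta N \<kappa> (coframe L i \<mu>)) z
        = delta N \<tau> (\<lambda>w. \<Sum>\<beta>\<in>UNIV. coframe L i \<beta> w * \<Gamma> \<beta> \<mu> \<kappa> w) z"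
      by (rule delta_cong[OF open_domain assms delta_coframe])
        (auto intro: smooth_on_delta smooth_barthel smooth_coframe open_domain)
    also have "\<dots> = (\<Sum>\<beta>\<in>UNIV. coframe L i \<beta> z * delta N \<tau> (\<Gamma> \<beta> \<mu> \<kappa>) z
        + delta N \<tau> (coframe L i \<beta>) z * \<Gamma> \<beta> \<mu> \<kappa> z)"
      by (simp add: delta_eq_frechet_derivative frechet_derivative_mult frechet_derivative_sum
          diff smooth_prod smooth_total smooth_coframe smooth_canonical_hcoef)
    finally have leibniz: "delta N \<tau> (delta N \<kappa> (coframe L i \<mu>)) z = \<dots>" .
    have parallel: "(\<Sum>\<eta>\<in>UNIV. delta N \<tau> (coframe L i \<eta>) z * \<Gamma> \<eta> \<mu> \<kappa> z)
        = (\<Sum>\<beta>\<in>UNIV. coframe L i \<beta> z * (\<Sum>\<eta>\<in>UNIV. \<Gamma> \<eta> \<mu> \<kappa> z * \<Gamma> \<beta> \<eta> \<tau> z))"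
      unfolding delta_coframe[OF assms] sum_distrib_left sum_distrib_right
      by (subst sum.swap) (simp add: mult_ac)
    show ?thesis
      by (simp only: leibniz sum.distrib parallel distrib_left)
  qed
  have "(\<Sum>\<beta>\<in>UNIV. coframe L i \<beta> z * (\<Sum>\<eta>\<in>UNIV. C \<beta> \<mu> \<eta> z * v_h_torsion (canonical_connection L) \<eta> \<nu> \<sigma> z))
      = (\<Sum>\<eta>\<in>UNIV. v_h_torsion (canonical_connection L) \<eta> \<nu> \<sigma> z * pdy \<eta> (coframe L i \<mu>) z)"
    unfolding pdy_coframe[OF assms] sum_distrib_left
    by (subst sum.swap) (simp add: mult_ac)
  with delta_commutator[OF open_domain assms smooth_coframe, of N \<sigma> \<nu> i \<mu>]
  show "(\<Sum>\<beta>\<in>UNIV. coframe L i \<beta> z * h_curvature (canonical_connection L) \<beta> \<mu> \<nu> \<sigma> z) = 0"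
    unfolding second h_curvature_def antisym_diff_def
    by (simp add: smooth_barthel distrib_left right_diff_distrib sum.distrib sum_subtractf v_h_torsion_def)
qed

lemma smooth_berwald_hcoef: "smooth_on S (G \<alpha> \<mu> \<nu>)"
  unfolding berwald_connection_def finsler_connection.simps
  by (intro smooth_on_pdy smooth_barthel open_domain)

lemma berwald_hcoef_symmetric:
  assumes "z \<in> S"
  shows "G \<alpha> \<mu> \<nu> z = G \<alpha> \<nu> \<mu> z"
  using partial_derivatives_commute(3)[OF open_domain assms smooth_spray]
  by (simp add: berwald_connection_def barthel_def)

lemma berwald_hcoef_eq: "G \<alpha> \<mu> \<nu> z = P \<alpha> \<mu> \<nu> z + \<Gamma> \<alpha> \<mu> \<nu> z"
  by (simp add: berwald_connection_def v_hv_torsion_def)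

lemma smooth_v_hv_torsion: "smooth_on S (P \<alpha> \<mu> \<nu>)"
  unfolding v_hv_torsion_def[abs_def] nonlin_connections
  by (intro smooth_on_diff smooth_on_pdy smooth_barthel smooth_canonical_hcoef open_domain)

lemma frechet_derivative_berwald_hcoef:
  assumes "z \<in> S"
  shows "frechet_derivative (G \<alpha> \<mu> \<nu>) (at z) v
    = frechet_derivative (P \<alpha> \<mu> \<nu>) (at z) v + frechet_derivative (\<Gamma> \<alpha> \<mu> \<nu>) (at z) v"
proof -
  have diff: "f differentiable (at z)" if "smooth_on S f" for f :: "'n cfun"
    using that assms by (rule smooth_on_imp_differentiable)
  have "P \<alpha> \<mu> \<nu> = (\<lambda>w. G \<alpha> \<mu> \<nu> w - \<Gamma> \<alpha> \<mu> \<nu> w)"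
    by (simp add: berwald_hcoef_eq fun_eq_iff)
  then show ?thesis
    by (simp add: frechet_derivative_diff diff smooth_berwald_hcoef smooth_canonical_hcoef)
qed

lemma delta_berwald_hcoef:
  assumes "z \<in> S"
  shows "delta N \<sigma> (G \<alpha> \<mu> \<nu>) z = delta N \<sigma> (P \<alpha> \<mu> \<nu>) z + delta N \<sigma> (\<Gamma> \<alpha> \<mu> \<nu>) z"
  by (simp add: delta_eq_frechet_derivative frechet_derivative_berwald_hcoef assms
      smooth_on_imp_differentiable[OF _ assms] smooth_berwald_hcoef smooth_canonical_hcoef smooth_v_hv_torsion)

lemma pdy_berwald_hcoef:
  assumes "z \<in> S"
  shows "pdy \<sigma> (G \<alpha> \<mu> \<nu>) z = pdy \<sigma> (P \<alpha> \<mu> \<nu>) z + pdy \<sigma> (\<Gamma> \<alpha> \<mu> \<nu>) z"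
  by (simp add: pdy_eq_frechet_derivative frechet_derivative_berwald_hcoef assms
      smooth_on_imp_differentiable[OF _ assms] smooth_berwald_hcoef smooth_canonical_hcoef smooth_v_hv_torsion)

text \<open>After the substitution \<open>G = P + \<Gamma>\<close> this is linear algebra, given that the \<open>h\<close>-curvature of
  the canonical connection vanishes. Of the two mixed products, \<open>P\<^sup>\<eta>\<^sub>\<mu>\<^sub>\<nu> \<Gamma>\<^sup>\<alpha>\<^sub>\<eta>\<^sub>\<sigma>\<close> is a term of \<open>P\<^sup>\<alpha>\<^sub>\<mu>\<^sub>\<nu>\<^sub>|\<^sub>\<sigma>\<close>, while
  \<open>\<Gamma>\<^sup>\<eta>\<^sub>\<mu>\<^sub>\<nu> P\<^sup>\<alpha>\<^sub>\<eta>\<^sub>\<sigma>\<close> has the same antisymmetric part as its term \<open>- P\<^sup>\<alpha>\<^sub>\<eta>\<^sub>\<nu> \<Gamma>\<^sup>\<eta>\<^sub>\<mu>\<^sub>\<sigma>\<close>.\<close>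

lemma berwald_h_curvature:
  assumes "z \<in> S"
  shows "h_curvature (berwald_connection L) \<alpha> \<mu> \<nu> \<sigma> z =
     antisym_diff (\<lambda>\<nu> \<sigma>. hcov (canonical_connection L) P \<alpha> \<mu> \<nu> \<sigma> z
        + (\<Sum>\<eta>\<in>UNIV. P \<eta> \<mu> \<nu> z * P \<alpha> \<eta> \<sigma> z)) \<nu> \<sigma>
     + (\<Sum>\<eta>\<in>UNIV. P \<alpha> \<mu> \<eta> z * h_h_torsion (canonical_connection L) \<eta> \<nu> \<sigma> z)
     - (\<Sum>\<eta>\<in>UNIV. C \<alpha> \<mu> \<eta> z * v_h_torsion (canonical_connection L) \<eta> \<nu> \<sigma> z)"
proof -
  have "vcoef (berwald_connection L) = (\<lambda>\<alpha> \<mu> \<nu> z. 0)" by (simp add: berwald_connection_def)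
  with canonical_h_curvature_eq_0[OF assms, of \<alpha> \<mu> \<nu> \<sigma>] show ?thesis
    by (simp add: h_curvature_def antisym_diff_def hcov_def h_h_torsion_def delta_berwald_hcoef[OF assms]
        berwald_hcoef_eq distrib_left distrib_right right_diff_distrib sum.distrib sum_subtractf mult.commute)
qed

end

section \<open>Tangent vectors with prescribed components in a chart\<close>

context smooth_manifold
begin

lemma chart_inj: "c \<in> A \<Longrightarrow> inj_on (cmap c) (cdom c)"
  using homeomorphic_imp_injective_map[OF chart_homeo] chart_open[of c]
  by (metis openin_subset topspace_subtopology_subset)

lemma cpoint_cmap: "c \<in> A \<Longrightarrow> p \<in> cdom c \<Longrightarrow> cpoint c (cmap c p) = p"
  by (simp add: cpoint_def chart_inj)

lemma open_chart_overlap: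
  assumes "c \<in> A" "c' \<in> A"
  shows "open (cmap c ` (cdom c \<inter> cdom c'))"
proof -
  have "openin (subtopology M (cdom c)) (cdom c \<inter> cdom c')"
    using chart_open[OF assms(2)] by (auto intro: openin_subtopology_Int2)
  then have "openin (top_of_set (cimage c)) (cmap c ` (cdom c \<inter> cdom c'))"
    using homeomorphic_imp_open_map[OF chart_homeo[OF assms(1)]] by (simp add: open_map_def)
  then show ?thesis
    using chart_open[OF assms(1)] by (simp add: openin_open_eq)
qed

lemma transition_cmap: "c \<in> A \<Longrightarrow> p \<in> cdom c \<Longrightarrow> transition c c' (cmap c p) = cmap c' p"
  by (simp add: transition_def cpoint_cmap)

lemma transition_has_derivative:
  assumes "c \<in> A" "c' \<in> A" "p \<in> cdom c" "p \<in> cdom c'"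
  shows "(transition c c' has_derivative frechet_derivative (transition c c') (at (cmap c p))) (at (cmap c p))"
  unfolding frechet_derivative_works[symmetric]
  by (rule smooth_on_imp_differentiable[OF compatible[OF assms(1,2)]]) (use assms(3,4) in blast)

text \<open>The transformation law between two further charts is the chain rule for
  \<open>transition c c'' = transition c' c'' \<circ> transition c c'\<close>, an identity that holds on the overlap of
  \<open>c\<close> and \<open>c'\<close>. The overlap is open in coordinates, so the derivatives at the point agree.\<close>

lemma tvec_of_in_tangent_space:
  assumes "c \<in> A" "p \<in> cdom c"
  shows "tvec_of A c p y \<in> tangent_space A p"
proof -
  have chain: "frechet_derivative (transition c c'') (at (cmap c p)) y
      = frechet_derivative (transition c' c'') (at (cmap c' p))
          (frechet_derivative (transition c c') (at (cmap c p)) y)"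
    if c': "c' \<in> A" "p \<in> cdom c'" and c'': "c'' \<in> A" "p \<in> cdom c''" for c' c''
  proof -
    let ?D = "frechet_derivative (transition c c') (at (cmap c p))"
    let ?E = "frechet_derivative (transition c' c'') (at (cmap c' p))"
    have "(transition c' c'' has_derivative ?E) (at (transition c c' (cmap c p)))"
      using transition_has_derivative c' c'' by (simp add: transition_cmap assms)
    from has_derivative_compose[OF transition_has_derivative this]
    have "((\<lambda>x. transition c' c'' (transition c c' x)) has_derivative (\<lambda>y. ?E (?D y))) (at (cmap c p))"
      using assms c' by simp
    then have "(transition c c'' has_derivative (\<lambda>y. ?E (?D y))) (at (cmap c p))"
      by (rule has_derivative_transform_within_open[OF _ open_chart_overlap[OF assms(1) c'(1)]])
        (use assms c' in \<open>auto simp: transition_cmap\<close>)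
    then show ?thesis by (metis frechet_derivative_at)
  qed
  have component: "tvec_of A c p y c' = frechet_derivative (transition c c') (at (cmap c p)) y"
    if "c' \<in> A" "p \<in> cdom c'" for c'
    by (simp add: tvec_of_def that)
  have "tvec_of A c p y c'' = frechet_derivative (transition c' c'') (at (cmap c' p)) (tvec_of A c p y c')"
    if "c' \<in> A" "p \<in> cdom c'" "c'' \<in> A" "p \<in> cdom c''" for c' c''
    unfolding component[OF that(1,2)] component[OF that(3,4)] by (rule chain[OF that])
  moreover have "\<forall>c'. c' \<notin> A \<or> p \<notin> cdom c' \<longrightarrow> tvec_of A c p y c' = 0"
    by (simp add: tvec_of_def)
  ultimately show ?thesis unfolding tangent_space_def by blast
qed

lemma tvec_of_own_chart:
  assumes "c \<in> A" "p \<in> cdom c"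
  shows "tvec_of A c p y c = y"
proof -
  have "(transition c c has_derivative (\<lambda>y. y)) (at (cmap c p))"
    by (rule has_derivative_transform_within_open[OF has_derivative_ident conjunct2[OF chart_open[OF assms(1)]]])
      (use assms chart_open in \<open>auto simp: transition_cmap\<close>)
  then show ?thesis
    using assms by (simp add: tvec_of_def frechet_derivative_at[symmetric])
qed

lemma tvec_of_in_slit_tangent_space:
  assumes "c \<in> A" "p \<in> cdom c" "y \<noteq> 0"
  shows "tvec_of A c p y \<in> slit_tangent_space A p"
proof -
  have "tvec_of A c p y \<noteq> (\<lambda>_. 0)"
    using tvec_of_own_chart[OF assms(1,2), of y] assms(3) by metis
  then show ?thesis
    unfolding slit_tangent_space_def using tvec_of_in_tangent_space[OF assms(1,2)] by blast
qed

end

section \<open>FP-spaces in a chart\<close>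

lemma invertible_matrix_of_independent_columns:
  fixes b :: "'n::finite \<Rightarrow> real^'n"
  assumes "inj b" "independent (range b)"
  shows "invertible (\<chi> \<alpha> i. b i $ \<alpha>)"
proof -
  have "u i = 0" if u: "(\<Sum>i\<in>UNIV. u i *s b i) = 0" for u i
  proof -
    have "(\<Sum>w\<in>range b. u (inv b w) *\<^sub>R w) = 0"
      unfolding sum.reindex[OF assms(1)] o_def inv_f_f[OF assms(1)]
      using u unfolding scalar_mult_eq_scaleR .
    from independentD[OF assms(2) _ order_refl this, of "b i"] have "u (inv b (b i)) = 0"
      by simp
    with assms(1) show ?thesis by simp
  qed
  moreover have "column i (\<chi> \<alpha> i. b i $ \<alpha>) = b i" for i
    by (simp add: column_def vec_eq_iff)
  ultimately show ?thesis
    unfolding invertible_left_inverse matrix_left_invertible_independent_columns by simp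
qed

text \<open>Linear independence is given at nonzero tangent vectors. A pair \<open>(x, y)\<close> with \<open>y \<noteq> 0\<close> represents
  one, because its components in the chart itself are \<open>y\<close>.\<close>

lemma (in FP_space) smooth_frame_in_chart:
  assumes "c \<in> A"
  shows "smooth_frame (frame_components A lam c) (cimage c \<times> (- {0}))"
proof
  show "open (cimage c \<times> (- {0 :: real^'n}))"
    using chart_open[OF assms] by (intro open_Times) auto
  show "smooth_on (cimage c \<times> (- {0})) (frame_components A lam c i \<alpha>)" for i \<alpha>
    by (rule smooth_sections[OF assms])
  fix z assume "z \<in> cimage c \<times> (- {0 :: real^'n})"
  then obtain p y where z: "z = (cmap c p, y)" "p \<in> cdom c" "y \<noteq> 0" by auto
  let ?v = "tvec_of A c p y"
  have "(\<chi> \<alpha> i. frame_components A lam c i \<alpha> z) = (\<chi> \<alpha> i. lam i p ?v c $ \<alpha>)"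
    using assms z by (simp add: frame_components_def cpoint_cmap)
  moreover have "invertible (\<chi> \<alpha> i. lam i p ?v c $ \<alpha>)"
    using linearly_independent[OF assms z(2) tvec_of_in_slit_tangent_space[OF assms z(2,3)]]
    by (intro invertible_matrix_of_independent_columns[of "\<lambda>i. lam i p ?v c"]) auto
  ultimately show "invertible (\<chi> \<alpha> i. frame_components A lam c i \<alpha> z)" by simp
qed

theorem proposition3p11:
  fixes M :: "'a topology" and A :: "('a, 'n::finite) chart set"
    and lam :: "'n \<Rightarrow> 'a \<Rightarrow> ('a, 'n) tvec \<Rightarrow> ('a, 'n) tvec"
    and F :: "'a \<Rightarrow> ('a, 'n) tvec \<Rightarrow> real"
    and c :: "('a, 'n) chart" and x y :: "real^'n"
  assumes "FP_space M A lam F" and "c \<in> A" and "x \<in> cimage c" and "y \<noteq> 0"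
  shows "let L = frame_components A lam c; z = (x, y);
             B = berwald_connection L; D = canonical_connection L;
             \<Gamma> = hcoef D; C = h_hv_torsion D; T = h_h_torsion D;
             P = v_hv_torsion D; R = v_h_torsion D
         in
           (\<forall>\<alpha> \<mu> \<nu>. h_h_torsion B \<alpha> \<mu> \<nu> z = 0) \<and>
           (\<forall>\<alpha> \<mu> \<nu>. h_hv_torsion B \<alpha> \<mu> \<nu> z = 0) \<and>
           (\<forall>\<alpha> \<mu> \<nu>. v_hv_torsion B \<alpha> \<mu> \<nu> z = 0) \<and>
           (\<forall>\<alpha> \<mu> \<nu>. v_v_torsion B \<alpha> \<mu> \<nu> z = 0) \<and>
           (\<forall>\<alpha> \<mu> \<nu> \<sigma>. h_curvature B \<alpha> \<mu> \<nu> \<sigma> z =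
              antisym_diff (\<lambda>\<nu> \<sigma>. hcov D P \<alpha> \<mu> \<nu> \<sigma> z + (\<Sum>\<eta>\<in>UNIV. P \<eta> \<mu> \<nu> z * P \<alpha> \<eta> \<sigma> z)) \<nu> \<sigma>
              + (\<Sum>\<eta>\<in>UNIV. P \<alpha> \<mu> \<eta> z * T \<eta> \<nu> \<sigma> z)
              - (\<Sum>\<eta>\<in>UNIV. C \<alpha> \<mu> \<eta> z * R \<eta> \<nu> \<sigma> z)) \<and>
           (\<forall>\<alpha> \<mu> \<sigma> \<nu>. v_curvature B \<alpha> \<mu> \<sigma> \<nu> z = 0) \<and>
           (\<forall>\<alpha> \<nu> \<mu> \<sigma>. hv_curvature B \<alpha> \<nu> \<mu> \<sigma> z =
              pdy \<sigma> (P \<alpha> \<nu> \<mu>) z + pdy \<sigma> (\<Gamma> \<alpha> \<nu> \<mu>) z)"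
proof -
  interpret FP_space M A lam F by fact
  interpret smooth_frame "frame_components A lam c" "cimage c \<times> (- {0})"
    by (rule smooth_frame_in_chart) fact
  let ?L = "frame_components A lam c" and ?z = "(x, y)"
  have z: "?z \<in> cimage c \<times> (- {0})" using assms(3,4) by simp
  have vcoef: "vcoef (berwald_connection ?L) = (\<lambda>\<alpha> \<mu> \<nu> z. 0)"
    by (simp add: berwald_connection_def)
  have delta_0: "delta N \<mu> (\<lambda>z. 0) ?z = 0" and pdy_0: "pdy \<mu> (\<lambda>z. 0) ?z = 0" for \<mu> N
    by (simp_all add: delta_eq_frechet_derivative pdy_eq_frechet_derivative)
  have vhv: "v_hv_torsion (berwald_connection ?L) \<alpha> \<mu> \<nu> z = 0" for \<alpha> \<mu> \<nu> z
    by (simp add: v_hv_torsion_def) (simp add: berwald_connection_def)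
  have "h_h_torsion (berwald_connection ?L) \<alpha> \<mu> \<nu> ?z = 0" for \<alpha> \<mu> \<nu>
    using berwald_hcoef_symmetric[OF z, of \<alpha> \<mu> \<nu>] by (simp add: h_h_torsion_def)
  moreover have "h_hv_torsion (canonical_connection ?L) = C"
    by (simp add: h_hv_torsion_def fun_eq_iff)
  ultimately show ?thesis
    unfolding Let_def
    apply (intro conjI allI)
    subgoal by simp
    subgoal by (simp add: h_hv_torsion_def vcoef)
    subgoal by (rule vhv)
    subgoal by (simp add: v_v_torsion_def vcoef)
    subgoal using berwald_h_curvature[OF z] by simp
    subgoal by (simp add: v_curvature_def vcoef antisym_diff_def pdy_0)
    subgoal by (simp add: hv_curvature_def vcoef hcov_def delta_0 pdy_berwald_hcoef[OF z])
    done
qed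

end
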